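(* Let $W$ be a weighing matrix $W(23,16)$. Then the graph $\Gamma(W)$ has at least $138$ edges.
   Context: A weighing matrix $W(n,k)$ is an $n\times n$ matrix $W$ with entries in $\{0,1,-1\}$ whose rows are pairwise orthogonal and have length $\sqrt{k}$, i.e. $WW^T=kI_n$. For a weighing matrix $W$ of type $W(23,16)$ and $i\in\{1,\ldots,23\}$, let $L_i\subseteq\{1,\ldots,23\}$ (the $i$-th "line") be the set of column positions at which the $i$-th row of $W$ is zero. The graph $\Gamma(W)$ is the simple graph with vertex set $\{1,2,\ldots,23\}$ in which distinct $i$ and $j$ are joined by an edge if and only if $|L_i\cap L_j|=1$. *)

theory Defs
  imports "Jordan_Normal_Form.Matrix"
begin

text \<open>
  Rows and columns are numbered \<open>0, \<dots>, n - 1\<close>, as usual for matrices of type \<^typ>\<open>int mat\<close>,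
  instead of \<open>1, \<dots>, n\<close>.
\<close>

definition weighing_matrix :: "nat \<Rightarrow> nat \<Rightarrow> int mat \<Rightarrow> bool" where
  "weighing_matrix n k W \<longleftrightarrow>
     W \<in> carrier_mat n n \<and>
     (\<forall>i<n. \<forall>j<n. W $$ (i, j) \<in> {0, 1, -1}) \<and>
     W * transpose_mat W = of_nat k \<cdot>\<^sub>m 1\<^sub>m n"

definition line :: "int mat \<Rightarrow> nat \<Rightarrow> nat set" where
  "line W i = {j \<in> {..<dim_col W}. W $$ (i, j) = 0}"

text \<open>A simple graph is given by its vertex set and its set of edges, each edge being the
  two-element set of its end points, so that every undirected edge is counted once.\<close>

type_synonym 'a graph = "'a set \<times> 'a set set"

definition edges :: "'a graph \<Rightarrow> 'a set set" where
  "edges G = snd G"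

definition Gamma :: "int mat \<Rightarrow> nat graph" where
  "Gamma W =
     ({..<dim_row W},
      {{i, j} | i j. i < dim_row W \<and> j < dim_row W \<and> i \<noteq> j \<and> card (line W i \<inter> line W j) = 1})"

end

theory Submission
  imports Defs "Jordan_Normal_Form.Determinant"
begin

text \<open>
  Every row and every column of \<open>W\<close> has \<open>7\<close> zeros, and orthogonality modulo \<open>2\<close> makes
  \<open>\<bar>L\<^sub>i \<inter> L\<^sub>j\<bar>\<close> odd for \<open>i \<noteq> j\<close>. Counting incidences with the points of \<open>L\<^sub>i\<close>, the \<open>22\<close> numbers
  \<open>\<bar>L\<^sub>i \<inter> L\<^sub>j\<bar>\<close> with \<open>j \<noteq> i\<close> add up to \<open>7 \<sqdot> 6 = 42\<close>. If \<open>d\<close> of them are \<open>1\<close>, then the others are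
  at least \<open>3\<close>, so \<open>d + 3 (22 - d) \<le> 42\<close> and \<open>d \<ge> 12\<close>. Hence \<open>\<Gamma>(W)\<close> has at least
  \<open>23 \<sqdot> 12 / 2 = 138\<close> edges.
\<close>

lemma weighing_matrix_row_inner:
  assumes "weighing_matrix n k W" "i < n" "j < n"
  shows "(\<Sum>c<n. W $$ (i, c) * W $$ (j, c)) = (if i = j then int k else 0)"
proof -
  have W: "W \<in> carrier_mat n n" and eq: "W * transpose_mat W = of_nat k \<cdot>\<^sub>m 1\<^sub>m n"
    using assms(1) by (auto simp: weighing_matrix_def)
  have "(W * transpose_mat W) $$ (i, j) = (\<Sum>c<n. W $$ (i, c) * W $$ (j, c))"
    using W assms(2,3) by (auto simp: scalar_prod_def lessThan_atLeast0)
  then show ?thesis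
    using assms(2,3) by (auto simp: eq split: if_splits)
qed

text \<open>Over a field, a right inverse of a square matrix is also a left inverse. The passage to
  rationals is what makes \<open>W\<^sup>T / k\<close> available as an inverse of \<open>W\<close>;
  the result turns facts about rows into facts about columns.\<close>

lemma weighing_matrix_transpose:
  assumes "weighing_matrix n k W" "k > 0"
  shows "weighing_matrix n k (transpose_mat W)"
proof -
  have W: "W \<in> carrier_mat n n"
    using assms(1) by (auto simp: weighing_matrix_def)
  define A :: "rat mat" where "A = map_mat of_int W"
  define B where "B = (1 / of_nat k) \<cdot>\<^sub>m transpose_mat A"
  have A: "A \<in> carrier_mat n n" and B: "B \<in> carrier_mat n n"
    using W by (auto simp: A_def B_def)
  have "A * B = 1\<^sub>m n"
  proof (rule eq_matI)
    fix i j assume "i < dim_row (1\<^sub>m n :: rat mat)" "j < dim_col (1\<^sub>m n :: rat mat)"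
    then have ij: "i < n" "j < n" by auto
    have "(A * B) $$ (i, j) = of_int (\<Sum>c<n. W $$ (i, c) * W $$ (j, c)) / of_nat k"
      using W ij
      by (auto simp: A_def B_def scalar_prod_def lessThan_atLeast0 sum_divide_distrib)
    then show "(A * B) $$ (i, j) = 1\<^sub>m n $$ (i, j)"
      using ij assms(2) unfolding weighing_matrix_row_inner[OF assms(1) ij] by auto
  qed (use A B in auto)
  then have BA: "B * A = 1\<^sub>m n"
    by (rule mat_mult_left_right_inverse[OF A B])
  have "transpose_mat W * W = of_nat k \<cdot>\<^sub>m 1\<^sub>m n"
  proof (rule eq_matI)
    fix i j assume "i < dim_row (of_nat k \<cdot>\<^sub>m 1\<^sub>m n :: int mat)" "j < dim_col (of_nat k \<cdot>\<^sub>m 1\<^sub>m n :: int mat)"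
    then have ij: "i < n" "j < n" by auto
    have "of_int ((transpose_mat W * W) $$ (i, j)) = of_nat k * (B * A) $$ (i, j)"
      using W ij assms(2)
      by (auto simp: A_def B_def scalar_prod_def sum_distrib_left)
    also have "\<dots> = of_int ((of_nat k \<cdot>\<^sub>m 1\<^sub>m n) $$ (i, j))"
      using ij by (simp add: BA)
    finally show "(transpose_mat W * W) $$ (i, j) = (of_nat k \<cdot>\<^sub>m 1\<^sub>m n) $$ (i, j)"
      by (simp only: of_int_eq_iff)
  qed (use W in auto)
  then show ?thesis
    using assms(1) W by (auto simp: weighing_matrix_def)
qed

lemma card_line:
  assumes "weighing_matrix n k W" "i < n"
  shows "card (line W i) + k = n"
proof -
  have W: "W \<in> carrier_mat n n" and entries: "\<forall>c<n. W $$ (i, c) \<in> {0, 1, -1}"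
    using assms by (auto simp: weighing_matrix_def)
  have "int k = (\<Sum>c<n. W $$ (i, c) * W $$ (i, c))"
    using weighing_matrix_row_inner[OF assms assms(2)] by simp
  \<comment> \<open>The squared norm of a row counts its nonzero entries, since each of these is 1
    or -1.\<close>
  also have "\<dots> = (\<Sum>c<n. 1 - of_bool (W $$ (i, c) = 0))"
    using entries by (intro sum.cong) auto
  also have "\<dots> = int n - int (card (line W i))"
    using W by (simp add: sum_subtractf line_def Int_def)
  finally show ?thesis by simp
qed

lemma card_zeros_col:
  assumes "weighing_matrix n k W" "k > 0" "c < n"
  shows "card {j \<in> {..<n}. W $$ (j, c) = 0} + k = n"
proof -
  have W: "W \<in> carrier_mat n n"
    using assms(1) by (auto simp: weighing_matrix_def)
  have "line (transpose_mat W) c = {j \<in> {..<n}. W $$ (j, c) = 0}"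
    using W assms(3) by (auto simp: line_def)
  then show ?thesis
    using card_line[OF weighing_matrix_transpose[OF assms(1,2)] assms(3)] by simp
qed

lemma parity_card_line_Int:
  assumes "weighing_matrix n k W" "i < n" "j < n" "i \<noteq> j"
  shows "even (card (line W i \<inter> line W j) + n)"
proof -
  have W: "W \<in> carrier_mat n n"
    and entries: "\<And>i c. i < n \<Longrightarrow> c < n \<Longrightarrow> W $$ (i, c) \<in> {0, 1, -1}"
    using assms by (auto simp: weighing_matrix_def)
  have odd_iff: "odd (W $$ (i, c)) \<longleftrightarrow> W $$ (i, c) \<noteq> 0" if "i < n" "c < n" for i c
    using entries[OF that] by auto
  have "even (\<Sum>c<n. W $$ (i, c) * W $$ (j, c))"
    using weighing_matrix_row_inner[OF assms(1-3)] assms(4) by simp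
  \<comment> \<open>Modulo 2 the inner product counts the columns in which neither row vanishes,
    that is, the complement of the union of the two lines.\<close>
  then have "even (card {c \<in> {..<n}. odd (W $$ (i, c) * W $$ (j, c))})"
    by (simp add: even_sum_iff)
  also have "{c \<in> {..<n}. odd (W $$ (i, c) * W $$ (j, c))} = {..<n} - (line W i \<union> line W j)"
    using W assms(2,3) odd_iff by (auto simp: line_def)
  finally have ev: "even (card ({..<n} - (line W i \<union> line W j)))" .
  have sub: "line W i \<union> line W j \<subseteq> {..<n}"
    using W by (auto simp: line_def)
  have fin: "finite (line W i)" "finite (line W j)"
    by (auto simp: line_def)
  have "card ({..<n} - (line W i \<union> line W j)) + card (line W i \<union> line W j) = n"
    using card_Diff_subset[of "line W i \<union> line W j" "{..<n}"] card_mono[OF _ sub] fin sub by simp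
  \<comment> \<open>Both lines have n - k points, so their union and their intersection have sizes
    of the same parity.\<close>
  moreover have "card (line W i \<union> line W j) + card (line W i \<inter> line W j) + 2 * k = 2 * n"
    using card_Un_Int[OF fin] card_line[OF assms(1,2)] card_line[OF assms(1,3)] by simp
  ultimately show ?thesis
    using ev by presburger
qed

lemma sum_card_line_Int:
  assumes "weighing_matrix n k W" "k > 0" "i < n"
  shows "(\<Sum>j\<in>{..<n} - {i}. card (line W i \<inter> line W j)) = (n - k) * (n - k - 1)"
proof -
  have W: "W \<in> carrier_mat n n"
    using assms(1) by (auto simp: weighing_matrix_def)
  have "(\<Sum>j\<in>{..<n} - {i}. card (line W i \<inter> line W j)) = (n - k - 1) * card (line W i)"
  \<comment> \<open>Double counting of the pairs (j, c) with j \<noteq> i and c a common zero of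
    rows i and j: each c on line i is a zero of n - k rows, one of which is row i itself.\<close>
  proof (rule trans[OF _ sum_multicount])
    show "(\<Sum>j\<in>{..<n} - {i}. card (line W i \<inter> line W j)) =
        (\<Sum>j\<in>{..<n} - {i}. card {c \<in> line W i. W $$ (j, c) = 0})"
      using W by (intro sum.cong refl arg_cong[where f = card]) (auto simp: line_def)
    show "\<forall>c\<in>line W i. card {j \<in> {..<n} - {i}. W $$ (j, c) = 0} = n - k - 1"
    proof
      fix c assume "c \<in> line W i"
      then have c: "c < n" "W $$ (i, c) = 0"
        using W by (auto simp: line_def)
      have "{j \<in> {..<n} - {i}. W $$ (j, c) = 0} = {j \<in> {..<n}. W $$ (j, c) = 0} - {i}"
        by auto
      then show "card {j \<in> {..<n} - {i}. W $$ (j, c) = 0} = n - k - 1"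
        using card_zeros_col[OF assms(1,2) c(1)] c assms(3) by simp
    qed
  qed (auto simp: line_def)
  also have "card (line W i) = n - k"
    using card_line[OF assms(1,3)] by simp
  finally show ?thesis by (simp add: mult.commute)
qed

text \<open>Handshake argument: the map j \<mapsto> {i, j} sends the neighbours of i injectively to
  edges through i, and by irreflexivity every edge has exactly two end points.\<close>

lemma card_edge_set_ge:
  assumes "finite V" "irreflp_on V R"
    and deg: "\<And>i. i \<in> V \<Longrightarrow> card {j \<in> V. R i j} \<ge> d"
  shows "card V * d \<le> 2 * card {{i, j} | i j. i \<in> V \<and> j \<in> V \<and> R i j}" (is "_ \<le> 2 * card ?E")
proof -
  have "?E \<subseteq> (\<lambda>(i, j). {i, j}) ` (V \<times> V)" by auto
  then have finE: "finite ?E"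
    using assms(1) by (meson finite_SigmaI finite_imageI finite_subset)
  have "d \<le> card {e \<in> ?E. i \<in> e}" if "i \<in> V" for i
  proof -
    have "card {j \<in> V. R i j} \<le> card {e \<in> ?E. i \<in> e}"
    proof (rule card_inj_on_le)
      show "inj_on (\<lambda>j. {i, j}) {j \<in> V. R i j}"
        by (auto simp: inj_on_def doubleton_eq_iff)
    qed (use that finE in auto)
    with deg[OF that] show ?thesis by simp
  qed
  then have "card V * d \<le> (\<Sum>i\<in>V. card {e \<in> ?E. i \<in> e})"
    using sum_bounded_below[of V d] by simp
  also have "\<dots> = 2 * card ?E"
  proof (rule sum_multicount[OF assms(1) finE], rule ballI)
    fix e assume "e \<in> ?E"
    then obtain i j where e: "e = {i, j}" "i \<in> V" "j \<in> V" "R i j" by auto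
    then have "i \<noteq> j" "{x \<in> V. x \<in> e} = {i, j}"
      using assms(2) by (auto simp: irreflp_on_def)
    then show "card {x \<in> V. x \<in> e} = 2" by simp
  qed
  finally show ?thesis .
qed

lemma card_Gamma_neighbours:
  assumes "weighing_matrix 23 16 W" "i < 23"
  shows "card {j \<in> {..<23}. i \<noteq> j \<and> card (line W i \<inter> line W j) = 1} \<ge> 12"
proof -
  let ?J = "{..<23} - {i}" and ?m = "\<lambda>j. card (line W i \<inter> line W j)"
  let ?N = "{j \<in> ?J. ?m j = 1}"
  have "3 * card ?J = (\<Sum>j\<in>?J. 3)" by simp
  \<comment> \<open>The correction term lifts the intersections of size 1 to 3, the next odd value.
    Summing over the 22 other rows gives 66 \<le> 42 + 2 \<open>card ?N\<close>.\<close>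
  also have "\<dots> \<le> (\<Sum>j\<in>?J. ?m j + 2 * of_bool (?m j = 1))"
  proof (rule sum_mono)
    fix j assume "j \<in> ?J"
    then have "odd (?m j)"
      using parity_card_line_Int[OF assms, of j] by auto
    then have "?m j = 1 \<or> ?m j \<ge> 3" by presburger
    then show "3 \<le> ?m j + 2 * of_bool (?m j = 1)" by auto
  qed
  also have "\<dots> = (\<Sum>j\<in>?J. ?m j) + 2 * card ?N"
    by (simp add: sum.distrib Int_def flip: sum_distrib_left)
  finally have "12 \<le> card ?N"
    using sum_card_line_Int[OF assms(1) _ assms(2)] assms(2) by simp
  also have "?N = {j \<in> {..<23}. i \<noteq> j \<and> ?m j = 1}" by auto
  finally show ?thesis .
qed

theorem proposition2:
  fixes W :: "int mat"
  assumes "weighing_matrix 23 16 W"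
  shows "card (edges (Gamma W)) \<ge> 138"
proof -
  have "dim_row W = 23"
    using assms by (auto simp: weighing_matrix_def)
  then have "edges (Gamma W) =
      {{i, j} | i j. i \<in> {..<23} \<and> j \<in> {..<23} \<and> (i \<noteq> j \<and> card (line W i \<inter> line W j) = 1)}"
    by (simp add: edges_def Gamma_def)
  moreover have "card {..<23 :: nat} * 12 \<le> 2 * card
      {{i, j} | i j. i \<in> {..<23} \<and> j \<in> {..<23} \<and> (i \<noteq> j \<and> card (line W i \<inter> line W j) = 1)}"
    by (rule card_edge_set_ge)
       (use card_Gamma_neighbours[OF assms] in \<open>auto simp: irreflp_on_def\<close>)
  ultimately show ?thesis by simp
qed

end
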